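(* Let $n\ge 1$ and $\theta\in(-n\frac{\pi}{2},n\frac{\pi}{2})$. The asymptotic subequation $\overrightarrow{\mathbf F}_\theta$ of $\mathbf F_\theta=\{A\in \mathrm{Sym}^2(\mathbb R^n): \mathrm{tr}(\arctan A)\ge\theta\}$ is given as follows. (1) If $\theta\in I_k=\left((n-2k)\frac{\pi}{2},\,(n-2(k-1))\frac{\pi}{2}\right)$ for some $k\in\{1,\dots,n\}$, then $\overrightarrow{\mathbf F}_\theta=\mathbf\Lambda_k:=\{A\in\mathrm{Sym}^2(\mathbb R^n):\lambda_k(A)\ge0\}$. (2) If $\theta=\theta_k=(n-2k)\frac{\pi}{2}$ for some $k\in\{1,\dots,n-1\}$, then $\overrightarrow{\mathbf F}_{\theta_k}=\mathbf\Lambda_k^{\sigma_{n-1}}$.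
   Context: $\mathrm{Sym}^2(\mathbb R^n)$ is the space of real symmetric $n\times n$ matrices, $\lambda_1(A)\le\dots\le\lambda_n(A)$ are the ordered eigenvalues of $A$, and $\mathrm{tr}(\arctan A)=\sum_{i=1}^n\arctan\lambda_i(A)$. Let $\mathcal P=\{A\ge0\}$. A subequation is a closed set $\mathbf F\subset\mathrm{Sym}^2(\mathbb R^n)$ with $\mathbf F+\mathcal P\subset\mathbf F$. The asymptotic interior of $\mathbf F$ is the set of all $A\in\mathrm{Sym}^2(\mathbb R^n)$ for which there exist $\epsilon>0$ and $t_0$ such that $t(A-\epsilon I)\in\mathbf F$ for all $t\ge t_0$. The asymptotic subequation $\overrightarrow{\mathbf F}$ is the closure of the asymptotic interior of $\mathbf F$. $\sigma_{j}(A)$ is the $j$-th elementary symmetric function of the eigenvalues of $A$. For each $A$ the polynomial $t\mapsto\sigma_{n-1}(tI+A)$ has degree $n-1$ and only real roots; the negatives of its roots, listed in increasing order with multiplicity, are denoted $\lambda_1^{\sigma_{n-1}}(A)\le\dots\le\lambda_{n-1}^{\sigma_{n-1}}(A)$. For $1\le k\le n-1$, $\mathbf\Lambda_k^{\sigma_{n-1}}:=\{A:\lambda_k^{\sigma_{n-1}}(A)\ge0\}$. *)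

theory Defs
  imports "HOL-Analysis.Analysis" "HOL-Computational_Algebra.Polynomial"
begin

definition Sym2 :: "(real ^ 'n ^ 'n) set" where
  "Sym2 = {A. transpose A = A}"

definition charpoly :: "real ^ 'n ^ 'n \<Rightarrow> real poly" where
  "charpoly A = det (mat [:0, 1:] - (\<chi> i j. [:A $ i $ j:]))"

text \<open>
  The \<open>k\<close>-th smallest eigenvalue, counted with multiplicity.
  Indices start at 1, as in \<open>\<lambda>\<^sub>1(A) \<le> \<dots> \<le> \<lambda>\<^sub>n(A)\<close>. A symmetric matrix has all its eigenvalues
  real, so that for it the list has length \<open>n\<close>; for other matrices or for an index outside
  \<open>{1..n}\<close> the value is irrelevant.
\<close>

definition eigval :: "nat \<Rightarrow> real ^ 'n ^ 'n \<Rightarrow> real" where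
  "eigval k A = sorted_list_of_multiset (proots (charpoly A)) ! (k - 1)"

definition tr_arctan :: "real ^ 'n ^ 'n \<Rightarrow> real" where
  "tr_arctan A = (\<Sum>i = 1..CARD('n). arctan (eigval i A))"

definition sigma :: "nat \<Rightarrow> real ^ 'n ^ 'n \<Rightarrow> real" where
  "sigma j A = (\<Sum>S | S \<subseteq> {1..CARD('n)} \<and> card S = j. \<Prod>i\<in>S. eigval i A)"

text \<open>
  The function \<open>t \<mapsto> \<sigma>\<^sub>j(tI + A)\<close> as a formal polynomial. For symmetric \<open>A\<close> the function is
  polynomial, because \<open>\<lambda>\<^sub>i(tI + A) = t + \<lambda>\<^sub>i(A)\<close>; uniqueness holds because the reals are infinite.
\<close>

definition sigma_poly :: "nat \<Rightarrow> real ^ 'n ^ 'n \<Rightarrow> real poly" where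
  "sigma_poly j A = (THE p. \<forall>t. poly p t = sigma j (t *\<^sub>R mat 1 + A))"

text \<open>\<open>\<lambda>\<^sub>k\<close> relative to \<open>\<sigma>\<^sub>j\<close>, again with indices starting at 1.\<close>

definition sigma_eigval :: "nat \<Rightarrow> nat \<Rightarrow> real ^ 'n ^ 'n \<Rightarrow> real" where
  "sigma_eigval j k A =
     sorted_list_of_multiset (image_mset uminus (proots (sigma_poly j A))) ! (k - 1)"

definition Lambda :: "nat \<Rightarrow> (real ^ 'n ^ 'n) set" where
  "Lambda k = {A \<in> Sym2. eigval k A \<ge> 0}"

definition Lambda_sigma :: "nat \<Rightarrow> nat \<Rightarrow> (real ^ 'n ^ 'n) set" where
  "Lambda_sigma j k = {A \<in> Sym2. sigma_eigval j k A \<ge> 0}"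

definition asymptotic_interior :: "(real ^ 'n ^ 'n) set \<Rightarrow> (real ^ 'n ^ 'n) set" where
  "asymptotic_interior F =
     {A \<in> Sym2. \<exists>\<epsilon>>0. \<exists>t0. \<forall>t\<ge>t0. t *\<^sub>R (A - \<epsilon> *\<^sub>R mat 1) \<in> F}"

text \<open>
  The closure is taken among all matrices; as \<open>Sym2\<close> is a closed subspace, this is
  the closure in \<open>Sym2\<close>.
\<close>

definition asymptotic_subequation :: "(real ^ 'n ^ 'n) set \<Rightarrow> (real ^ 'n ^ 'n) set" where
  "asymptotic_subequation F = closure (asymptotic_interior F)"

definition F_arctan :: "real \<Rightarrow> (real ^ 'n ^ 'n) set" where
  "F_arctan \<theta> = {A \<in> Sym2. tr_arctan A \<ge> \<theta>}"

end

theory Submission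
  imports Defs "HOL-Computational_Algebra.Fundamental_Theorem_Algebra"
begin

text \<open>
  The eigenvalues of \<open>t (A - \<epsilon> I)\<close> are \<open>t (\<lambda>\<^sub>i - \<epsilon>)\<close>, so \<open>tr (arctan (t (A - \<epsilon> I)))\<close> tends to
  \<open>\<pi> / 2\<close> times the signature of \<open>A - \<epsilon> I\<close>. For \<open>\<theta> \<in> I\<^sub>k\<close> this decides membership, and the
  asymptotic interior is \<open>{\<lambda>\<^sub>k > 0}\<close>. For \<open>\<theta> = \<theta>\<^sub>k\<close> the only undecided case is
  \<open>\<lambda>\<^sub>k < \<epsilon> < \<lambda>\<^sub>k\<^sub>+\<^sub>1\<close>, where \<open>\<theta>\<^sub>k\<close> exceeds the trace by asymptotically
  \<open>1 / t\<close> times \<open>\<Sum>\<^sub>i 1 / (\<lambda>\<^sub>i - \<epsilon>)\<close>. That sum is minus the logarithmic derivative of the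
  characteristic polynomial \<open>p\<close> at \<open>\<epsilon>\<close>, so its sign tells on which side of \<open>\<epsilon>\<close> the critical point
  of \<open>p\<close> between \<open>\<lambda>\<^sub>k\<close> and \<open>\<lambda>\<^sub>k\<^sub>+\<^sub>1\<close> lies. Up to sign and the reflection \<open>t \<mapsto> - t\<close>,
  \<open>\<sigma>\<^sub>n\<^sub>-\<^sub>1(t I + A)\<close> is the derivative of \<open>p\<close>, so this critical point is the \<open>k\<close>-th
  \<open>\<sigma>\<^sub>n\<^sub>-\<^sub>1\<close>-eigenvalue, and the asymptotic interior is the set where it is positive.
  The closures follow from the shift \<open>A + \<delta> I\<close> and the compactness of bounded tuples of roots.
\<close>

section \<open>Real polynomials recovered from their lists of roots\<close>

definition root_poly :: "real list \<Rightarrow> real poly" where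
  "root_poly xs = (\<Prod>x\<leftarrow>xs. [:- x, 1:])"

definition real_roots :: "real poly \<Rightarrow> real list" where
  "real_roots p = sorted_list_of_multiset (proots p)"

lemma root_poly_simps [simp]:
  "root_poly [] = 1" "root_poly (x # xs) = [:- x, 1:] * root_poly xs"
  by (simp_all add: root_poly_def)

lemma root_poly_nonzero [simp]: "root_poly xs \<noteq> 0"
  unfolding root_poly_def by (auto simp: prod_list_zero_iff)

lemma degree_root_poly [simp]: "degree (root_poly xs) = length xs"
proof (induction xs)
  case (Cons x xs)
  then show ?case
    by (subst root_poly_simps, subst degree_mult_eq) auto
qed simp

lemma lead_coeff_root_poly [simp]: "coeff (root_poly xs) (length xs) = 1"
proof -
  have "lead_coeff (root_poly xs) = 1"
    by (induction xs) (simp_all add: lead_coeff_mult del: mult_pCons_left)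
  then show ?thesis by simp
qed

lemma proots_root_poly [simp]: "proots (root_poly xs) = mset xs"
proof (induction xs)
  case (Cons x xs)
  then show ?case
    by (subst root_poly_simps, subst proots_mult) auto
qed simp

lemma poly_root_poly: "poly (root_poly xs) t = (\<Prod>x\<leftarrow>xs. t - x)"
  by (induction xs) (simp_all add: algebra_simps)

lemma poly_root_poly_nth: "poly (root_poly xs) t = (\<Prod>i<length xs. t - xs ! i)"
  unfolding poly_root_poly
  by (simp add: prod.list_conv_set_nth atLeast0LessThan)

lemma sorted_real_roots [simp]: "sorted (real_roots p)"
  by (simp add: real_roots_def)

lemma mset_real_roots [simp]: "mset (real_roots p) = proots p"
  by (simp add: real_roots_def)

lemma set_real_roots: "p \<noteq> 0 \<Longrightarrow> set (real_roots p) = {x. poly p x = 0}"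
  by (simp add: real_roots_def)

lemma real_roots_smult [simp]: "c \<noteq> 0 \<Longrightarrow> real_roots (smult c p) = real_roots p"
  by (simp add: real_roots_def)

lemma real_roots_root_poly: "sorted xs \<Longrightarrow> real_roots (root_poly xs) = xs"
  by (simp add: real_roots_def sorted_sort_id)

lemma length_real_roots: "length (real_roots p) = size (proots p)"
  by (metis mset_real_roots size_mset)

text \<open>Splitting off a linear factor takes one copy of its root out of \<open>proots\<close>,
  so all of them can be split off in turn. When they number \<open>degree p\<close>, the remaining
  quotient has degree 0, and the leading coefficient identifies it.\<close>

lemma smult_root_poly_real_roots:
  assumes "p \<noteq> 0" "size (proots p) = degree p"
  shows "p = smult (lead_coeff p) (root_poly (real_roots p))"
proof -
  \<comment> \<open>Stated for any list within \<open>proots p\<close> and with \<open>p\<close>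
    varying, so that the induction can pass to the cofactor of a linear factor.\<close>
  have "\<exists>q. p = q * root_poly xs" if "mset xs \<subseteq># proots p" for xs
    using that assms(1)
  proof (induction xs arbitrary: p)
    case (Cons x xs)
    have "x \<in># proots p"
      using Cons.prems(1) by (simp add: insert_subset_eq_iff)
    then have "poly p x = 0" using Cons.prems(2) by simp
    then obtain r where r: "p = [:- x, 1:] * r"
      by (metis poly_eq_0_iff_dvd dvdE)
    with Cons.prems have "r \<noteq> 0" by auto
    with r have "proots p = add_mset x (proots r)"
      by (subst r, subst proots_mult) auto
    with Cons.prems have "mset xs \<subseteq># proots r" by simp
    with Cons.IH \<open>r \<noteq> 0\<close> obtain q where "r = q * root_poly xs" by blast
    with r show ?case by (intro exI[of _ q]) (simp add: algebra_simps)
  qed simp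
  then obtain q where q: "p = q * root_poly (real_roots p)"
    by (metis mset_real_roots subset_mset.order_refl)
  have len: "length (real_roots p) = degree p"
    using assms(2) by (simp add: length_real_roots)
  have "q \<noteq> 0" using q assms by auto
  then have "degree p = degree q + length (real_roots p)"
    by (subst q, subst degree_mult_eq) auto
  with len have "degree q = 0" by simp
  then obtain c where c: "q = [:c:]" by (metis degree_eq_zeroE)
  with q have p: "p = smult c (root_poly (real_roots p))" by simp
  have "lead_coeff (smult c (root_poly (real_roots p))) = c"
    by (simp add: lead_coeff_smult)
  with p have "lead_coeff p = c" by simp
  with p show "p = smult (lead_coeff p) (root_poly (real_roots p))" by simp
qed

section \<open>Real-rootedness of the characteristic polynomial of a symmetric matrix\<close>

lemma map_poly_of_real_mult:
  "map_poly of_real (p * q) =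
     (map_poly of_real p * map_poly of_real q :: 'a :: {real_algebra_1, comm_ring_1} poly)"
  by (rule poly_eqI) (simp add: coeff_map_poly coeff_mult)

lemma poly_map_poly_of_real:
  "poly (map_poly of_real p) (of_real x) = (of_real (poly p x) :: 'a :: {real_algebra_1, comm_ring_1})"
  by (induction p) (auto simp: map_poly_pCons)

text \<open>The fundamental theorem of algebra supplies a complex root, which the hypothesis makes
  real. The hypothesis passes to the cofactor, whose complex roots are roots of \<open>p\<close>, so
  induction on the degree applies.\<close>

lemma size_proots_eq_degree:
  fixes p :: "real poly"
  assumes "p \<noteq> 0" and "\<And>z :: complex. poly (map_poly of_real p) z = 0 \<Longrightarrow> Im z = 0"
  shows "size (proots p) = degree p"
  using assms
proof (induction "degree p" arbitrary: p)
  case 0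
  then show ?case using size_proots_le[of p] by simp
next
  case (Suc d)
  have "degree (map_poly of_real p :: complex poly) = Suc d"
    using Suc.hyps(2) by (simp add: degree_map_poly)
  then obtain z :: complex where z: "poly (map_poly of_real p) z = 0"
    using fundamental_theorem_of_algebra_alt[of "map_poly of_real p"]
    by (metis degree_pCons_0 nat.simps(3))
  then have "z = of_real (Re z)"
    using Suc.prems(2) by (simp add: complex_eq_iff)
  with z have "poly p (Re z) = 0"
    by (metis of_real_eq_0_iff poly_map_poly_of_real)
  then obtain r where r: "p = [:- Re z, 1:] * r"
    by (metis poly_eq_0_iff_dvd dvdE)
  with Suc.prems have "r \<noteq> 0" by auto
  then have deg: "degree p = Suc (degree r)"
    by (subst r, subst degree_mult_eq) auto
  have "Im w = 0" if "poly (map_poly of_real r) w = 0" for w :: complex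
  proof (rule Suc.prems(2))
    show "poly (map_poly of_real p) w = 0"
      using that unfolding r map_poly_of_real_mult by simp
  qed
  with Suc.hyps deg \<open>r \<noteq> 0\<close> have "size (proots r) = degree r" by auto
  moreover have "proots p = add_mset (Re z) (proots r)"
    using \<open>r \<noteq> 0\<close> by (subst r, subst proots_mult) auto
  ultimately show ?case using deg by simp
qed

text \<open>The Leibniz formula is built from sums, products and signs only. The homomorphisms of
  interest are evaluations of polynomial entries at a real or a complex point.\<close>

lemma det_hom:
  fixes h :: "'a :: comm_ring_1 \<Rightarrow> 'b :: comm_ring_1" and M :: "'a ^ 'n ^ 'n"
  assumes add: "\<And>x y. h (x + y) = h x + h y" and mult: "\<And>x y. h (x * y) = h x * h y"
    and one: "h 1 = 1"
  shows "h (det M) = det (\<chi> i j. h (M $ i $ j))"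
proof -
  have zero: "h 0 = 0" using add[of 0 0] by simp
  have neg: "h (- x) = - h x" for x
    using add[of x "- x"] zero by (simp add: eq_neg_iff_add_eq_0 add.commute)
  have sum: "h (sum f S) = (\<Sum>s\<in>S. h (f s))" for f :: "('n \<Rightarrow> 'n) \<Rightarrow> 'a" and S
    by (induction S rule: infinite_finite_induct) (simp_all add: zero add)
  have prod: "h (prod f S) = (\<Prod>s\<in>S. h (f s))" for f :: "'n \<Rightarrow> 'a" and S
    by (induction S rule: infinite_finite_induct) (simp_all add: one mult)
  have "h (of_int (sign p)) = of_int (sign p)" for p :: "'n \<Rightarrow> 'n"
    by (simp add: sign_def one neg)
  then show ?thesis
    unfolding det_def by (simp add: sum mult prod)
qed

lemma poly_charpoly: "poly (charpoly A) x = det (x *\<^sub>R mat 1 - A)"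
proof -
  have "poly (charpoly A) x =
      det (\<chi> i j. poly ((mat [:0, 1:] - (\<chi> i j. [:A $ i $ j:])) $ i $ j) x)"
    unfolding charpoly_def by (rule det_hom) simp_all
  also have "(\<chi> i j. poly ((mat [:0, 1:] - (\<chi> i j. [:A $ i $ j:])) $ i $ j) x) = x *\<^sub>R mat 1 - A"
    by (simp add: vec_eq_iff mat_def)
  finally show ?thesis .
qed

lemma poly_charpoly_complex:
  "poly (map_poly of_real (charpoly A)) (z :: complex) =
     det (mat z - (\<chi> i j. of_real (A $ i $ j)))"
proof -
  let ?h = "\<lambda>p. poly (map_poly of_real p) z :: complex"
  have "?h (charpoly A) =
      det (\<chi> i j. ?h ((mat [:0, 1:] - (\<chi> i j. [:A $ i $ j:])) $ i $ j))"
    unfolding charpoly_def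
  proof (rule det_hom)
    fix p q :: "real poly"
    have "map_poly of_real (p + q) = (map_poly of_real p + map_poly of_real q :: complex poly)"
      by (rule poly_eqI) (simp add: coeff_map_poly)
    then show "?h (p + q) = ?h p + ?h q" by simp
  qed (simp_all add: map_poly_of_real_mult)
  also have "(\<chi> i j. ?h ((mat [:0, 1:] - (\<chi> i j. [:A $ i $ j:])) $ i $ j)) =
      mat z - (\<chi> i j. of_real (A $ i $ j))"
    by (auto simp add: vec_eq_iff mat_def map_poly_pCons)
  finally show ?thesis .
qed

text \<open>In the Leibniz expansion the identity permutation contributes a product of monic linear
  entries. Any other permutation meets an off-diagonal entry, which is constant, so its term has
  degree below \<open>CARD('n)\<close>.\<close>

lemma charpoly_monic:
  fixes A :: "real ^ 'n ^ 'n"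
  shows "degree (charpoly A) = CARD('n)" and "lead_coeff (charpoly A) = 1"
proof -
  define M where "M = mat [:0, 1:] - (\<chi> i j. [:A $ i $ j:])"
  have diag: "M $ i $ i = [:- (A $ i $ i), 1:]" for i
    by (simp add: M_def mat_def)
  have off: "degree (M $ i $ j) = 0" if "i \<noteq> j" for i j
    using that by (simp add: M_def mat_def)
  have deg_M: "degree (M $ i $ j) \<le> 1" for i j
    by (cases "i = j") (simp_all add: diag off)
  define P where "P = (\<Prod>i\<in>UNIV. M $ i $ i)"
  define Q where "Q = (\<Sum>p\<in>{p. p permutes UNIV} - {id}. of_int (sign p) * (\<Prod>i\<in>UNIV. M $ i $ p i))"
  have "charpoly A = (\<Sum>p\<in>{p. p permutes UNIV}. of_int (sign p) * (\<Prod>i\<in>UNIV. M $ i $ p i))"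
    by (simp add: charpoly_def det_def M_def)
  also have "\<dots> = P + Q"
    unfolding Q_def
    by (subst sum.remove[of _ id]) (auto simp: finite_permutations permutes_id P_def)
  finally have eq: "charpoly A = P + Q" .
  \<comment> \<open>Enumerating the index type turns the diagonal product into a
    \<open>root_poly\<close>, whose degree and leading coefficient are known.\<close>
  have "P = root_poly (map (\<lambda>i. A $ i $ i) xs)" if "distinct xs" "set xs = UNIV" for xs
    using that unfolding P_def root_poly_def
    by (simp add: diag prod.distinct_set_conv_list[symmetric] o_def)
  then obtain xs where xs: "P = root_poly (map (\<lambda>i. A $ i $ i) xs)" "distinct xs" "set xs = UNIV"
    using finite_distinct_list[of "UNIV :: 'n set"] by auto
  then have len: "length xs = CARD('n)"
    by (metis distinct_card)
  have P: "degree P = CARD('n)" "coeff P CARD('n) = 1"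
    using lead_coeff_root_poly[of "map (\<lambda>i. A $ i $ i) xs"] xs(1) len by simp_all
  have "degree (of_int (sign p) * (\<Prod>i\<in>UNIV. M $ i $ p i)) < CARD('n)" if "p \<noteq> id" for p
  proof -
    from that obtain i where i: "p i \<noteq> i" by (auto simp: fun_eq_iff)
    have "degree (of_int (sign p) * (\<Prod>i\<in>UNIV. M $ i $ p i)) \<le> degree (\<Prod>i\<in>UNIV. M $ i $ p i)"
      by (simp add: sign_def)
    also have "\<dots> \<le> (\<Sum>i\<in>UNIV. degree (M $ i $ p i))"
      using degree_prod_sum_le[of UNIV "\<lambda>i. M $ i $ p i"] by (simp add: o_def)
    also have "\<dots> < (\<Sum>i\<in>(UNIV :: 'n set). 1)"
    proof (rule sum_strict_mono_ex1)
      show "\<exists>a\<in>UNIV. degree (M $ a $ p a) < 1"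
        using off[of i "p i"] i by (intro bexI[of _ i]) auto
    qed (auto simp: deg_M[simplified])
    finally show ?thesis by simp
  qed
  then have Q: "degree Q < CARD('n)"
    unfolding Q_def by (intro degree_sum_less) auto
  show "degree (charpoly A) = CARD('n)"
    using degree_add_eq_left[of Q P] P Q eq by simp
  moreover have "coeff Q CARD('n) = 0" using Q by (rule coeff_eq_0)
  ultimately show "lead_coeff (charpoly A) = 1"
    using P eq by simp
qed

lemma charpoly_nonzero [simp]: "charpoly A \<noteq> 0"
  using charpoly_monic(2)[of A] by auto

lemma det_zero_imp_ker:
  fixes M :: "'a :: field ^ 'n ^ 'n"
  assumes "det M = 0"
  obtains v where "v \<noteq> 0" "M *v v = 0"
  using assms invertible_det_nz[of M] matrix_left_invertible_ker[of M]
  unfolding invertible_left_inverse by blast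

text \<open>If \<open>A v = z v\<close>, then \<open>z |v|\<^sup>2\<close> is the value of a Hermitian form, hence real.\<close>

lemma charpoly_complex_root_real:
  fixes A :: "real ^ 'n ^ 'n"
  assumes "A \<in> Sym2" and "poly (map_poly of_real (charpoly A)) (z :: complex) = 0"
  shows "Im z = 0"
proof -
  define C :: "complex ^ 'n ^ 'n" where "C = (\<chi> i j. of_real (A $ i $ j))"
  obtain v where v: "v \<noteq> 0" "(mat z - C) *v v = 0"
    using det_zero_imp_ker assms(2)[unfolded poly_charpoly_complex] unfolding C_def by blast
  have sym: "A $ i $ j = A $ j $ i" for i j
    using assms(1) by (metis (mono_tags) Sym2_def mem_Collect_eq transpose_def vec_lambda_beta)
  have eig: "z * v $ i = (\<Sum>j\<in>UNIV. of_real (A $ i $ j) * v $ j)" for i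
  proof -
    have "((mat z - C) *v v) $ i = (\<Sum>j\<in>UNIV. (if i = j then z else 0) * v $ j) -
        (\<Sum>j\<in>UNIV. of_real (A $ i $ j) * v $ j)"
      by (simp add: matrix_vector_mult_def mat_def C_def left_diff_distrib sum_subtractf)
    also have "(\<Sum>j\<in>UNIV. (if i = j then z else 0) * v $ j) = z * v $ i"
      by (simp add: if_distrib[where f = "\<lambda>x. x * _"] cong: if_cong)
    finally show ?thesis using v(2) by simp
  qed
  define N where "N = (\<Sum>i\<in>UNIV. (cmod (v $ i))\<^sup>2)"
  define q where "q = (\<Sum>i\<in>UNIV. \<Sum>j\<in>UNIV. cnj (v $ i) * of_real (A $ i $ j) * v $ j)"
  \<comment> \<open>Conjugation turns the summand at \<open>(i, j)\<close> into the one at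
    \<open>(j, i)\<close>, by symmetry of \<open>A\<close>.\<close>
  have "cnj q = (\<Sum>i\<in>UNIV. \<Sum>j\<in>UNIV. cnj (v $ j) * of_real (A $ j $ i) * v $ i)"
    unfolding q_def by (simp add: sym algebra_simps)
  also have "\<dots> = q" unfolding q_def by (rule sum.swap)
  finally have "Im q = 0" by (simp add: complex_eq_iff)
  have "q = (\<Sum>i\<in>UNIV. cnj (v $ i) * (z * v $ i))"
    unfolding q_def eig by (simp add: sum_distrib_left mult.assoc)
  also have "\<dots> = z * of_real N"
  proof -
    have "cnj x * (z * x) = z * of_real ((cmod x)\<^sup>2)" for x
      by (simp only: complex_norm_square mult_ac)
    then show ?thesis
      unfolding N_def of_real_sum sum_distrib_left by (simp only:)
  qed
  finally have "q = z * of_real N" .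
  moreover have "N > 0"
  proof -
    obtain i where "v $ i \<noteq> 0" using v(1) by (auto simp: vec_eq_iff)
    then show ?thesis unfolding N_def by (intro sum_pos2[of _ i]) auto
  qed
  ultimately show ?thesis using \<open>Im q = 0\<close> by simp
qed

abbreviation eigenvalues :: "real ^ 'n ^ 'n \<Rightarrow> real list" where
  "eigenvalues A \<equiv> real_roots (charpoly A)"

lemma eigval_eq_nth: "eigval k A = eigenvalues A ! (k - 1)"
  by (simp add: eigval_def real_roots_def)

lemma charpoly_Sym2:
  fixes A :: "real ^ 'n ^ 'n"
  assumes "A \<in> Sym2"
  shows "charpoly A = root_poly (eigenvalues A)" and "length (eigenvalues A) = CARD('n)"
proof -
  have "size (proots (charpoly A)) = degree (charpoly A)"
    using assms by (intro size_proots_eq_degree charpoly_complex_root_real) simp_all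
  then show "charpoly A = root_poly (eigenvalues A)" "length (eigenvalues A) = CARD('n)"
    using charpoly_monic[of A] smult_root_poly_real_roots[of "charpoly A"]
    by (simp_all add: length_real_roots)
qed

section \<open>Eigenvalues of a shifted and scaled matrix\<close>

lemma Sym2_shift:
  assumes "A \<in> Sym2"
  shows "t *\<^sub>R (A - e *\<^sub>R mat 1) \<in> Sym2"
  using assms by (auto simp: Sym2_def transpose_def mat_def vec_eq_iff)

lemma poly_root_poly_affine:
  fixes t e :: real
  assumes "t > 0"
  shows "poly (root_poly (map (\<lambda>x. t * (x - e)) xs)) y =
    t ^ length xs * poly (root_poly xs) (e + y / t)"
  using assms by (induction xs) (simp_all add: field_simps)

text \<open>Pulling the factor \<open>t\<close> out of each row expresses the new characteristic
  polynomial at \<open>x\<close> through the old one at \<open>e + x / t\<close>. As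
  \<open>t\<close> is positive, the transformed list is still sorted, so it is the eigenvalue list
  itself and not just a permutation of it.\<close>

lemma eigenvalues_affine:
  fixes A :: "real ^ 'n ^ 'n"
  assumes A: "A \<in> Sym2" and t: "t > 0"
  shows "eigenvalues (t *\<^sub>R (A - e *\<^sub>R mat 1)) = map (\<lambda>x. t * (x - e)) (eigenvalues A)"
proof -
  let ?B = "t *\<^sub>R (A - e *\<^sub>R mat 1)"
  have "poly (charpoly ?B) x = poly (root_poly (map (\<lambda>x. t * (x - e)) (eigenvalues A))) x" for x
  proof -
    have "x *\<^sub>R mat 1 - ?B = t *\<^sub>R ((e + x / t) *\<^sub>R mat 1 - A)"
      using t by (simp add: vec_eq_iff field_simps)
    also have "\<dots> = (\<chi> i. t *s ((e + x / t) *\<^sub>R mat 1 - A) $ i)"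
      by (simp add: vec_eq_iff right_diff_distrib)
    finally have "det (x *\<^sub>R mat 1 - ?B) = t ^ CARD('n) * det ((e + x / t) *\<^sub>R mat 1 - A)"
      by (simp only: det_rows_mul vec_lambda_eta prod_constant)
    then show ?thesis
      using poly_charpoly[of A "e + x / t"] poly_charpoly[of ?B x] charpoly_Sym2[OF A]
        poly_root_poly_affine[OF t, of e "eigenvalues A" x] by simp
  qed
  then have "charpoly ?B = root_poly (map (\<lambda>x. t * (x - e)) (eigenvalues A))"
    by (simp add: poly_eq_poly_eq_iff[symmetric] fun_eq_iff)
  then have "eigenvalues ?B = real_roots (root_poly (map (\<lambda>x. t * (x - e)) (eigenvalues A)))"
    by simp
  also have "\<dots> = map (\<lambda>x. t * (x - e)) (eigenvalues A)"
    using t by (intro real_roots_root_poly) (simp add: sorted_wrt_map sorted_wrt_mono_rel[of _ "(\<le>)"])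
  finally show ?thesis .
qed

section \<open>Interlacing critical points of real-rooted polynomials\<close>

text \<open>The combinatorial half of the interlacing. The choice \<open>g\<close> is applied to
  neighbours: equal neighbours repeat their value, which leaves a value of multiplicity m exactly m
  - 1 times, and distinct neighbours enclose a new point. The counts are in the form needed for
  comparison with root orders of a derivative.\<close>

lemma gap_choice_props:
  fixes xs :: "real list" and g :: "real \<Rightarrow> real \<Rightarrow> real"
  assumes "sorted xs" and "\<And>a. g a a = a"
    and "\<And>a b. a \<in> set xs \<Longrightarrow> b \<in> set xs \<Longrightarrow> a < b \<Longrightarrow> a < g a b \<and> g a b < b"
  defines "cs \<equiv> map2 g xs (tl xs)"
  shows "sorted cs"
    and "\<And>a. a \<in> set xs \<Longrightarrow> Suc (count (mset cs) a) = count (mset xs) a"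
    and "\<And>a. a \<notin> set xs \<Longrightarrow> count (mset cs) a \<le> 1"
proof -
  \<comment> \<open>The lower bound \<open>hd xs\<close> is carried along so that sortedness and the
    counts survive a new point at the front.\<close>
  have "sorted cs \<and> (\<forall>c\<in>set cs. hd xs \<le> c) \<and>
      (\<forall>a\<in>set xs. Suc (count (mset cs) a) = count (mset xs) a) \<and>
      (\<forall>a. a \<notin> set xs \<longrightarrow> count (mset cs) a \<le> 1)"
    using assms(1,3) unfolding cs_def
  proof (induction xs rule: induct_list012)
    case (3 x y zs)
    define ds where "ds = map2 g (y # zs) zs"
    have cs: "map2 g (x # y # zs) (tl (x # y # zs)) = g x y # ds"
      by (simp add: ds_def)
    have IH: "sorted ds" "\<And>c. c \<in> set ds \<Longrightarrow> y \<le> c"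
        "\<And>a. a \<in> set (y # zs) \<Longrightarrow> Suc (count (mset ds) a) = count (mset (y # zs)) a"
        "\<And>a. a \<notin> set (y # zs) \<Longrightarrow> count (mset ds) a \<le> 1"
      using 3 unfolding ds_def by auto
    have sorted: "x \<le> y" "\<And>z. z \<in> set zs \<Longrightarrow> y \<le> z" using "3.prems"(1) by auto
    show ?case
    proof (cases "x = y")
      case True
      have "g x y = y" using assms(2) True by simp
      then show ?thesis
        unfolding cs using IH True by auto
    next
      case False
      with sorted have "x < y" by simp
      with "3.prems"(2) have g: "x < g x y" "g x y < y" by auto
      have out: "count (mset ds) a = 0" if "a < y" for a
        using IH(2)[of a] that by (auto simp: count_eq_zero_iff)
      have out': "count (mset (y # zs)) a = 0" if "a < y" for a
        using sorted(2)[of a] that by (auto simp: count_eq_zero_iff simp del: count_add_mset)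
      have "Suc (count (mset (g x y # ds)) a) = count (mset (x # y # zs)) a"
        if "a \<in> set (x # y # zs)" for a
      proof (cases "a = x")
        case True
        then show ?thesis using g out[of x] out'[of x] \<open>x < y\<close> by (simp add: count_mset_0_iff[THEN iffD2])
      next
        case False
        with that have "a \<in> set (y # zs)" by simp
        with sorted(2) g have "g x y \<noteq> a" by force
        with IH(3)[OF \<open>a \<in> set (y # zs)\<close>] False show ?thesis by simp
      qed
      moreover have "count (mset (g x y # ds)) a \<le> 1" if "a \<notin> set (x # y # zs)" for a
        using IH(4)[of a] that out[of "g x y"] g by auto
      moreover have "sorted (g x y # ds)" "\<forall>c\<in>set (g x y # ds). x \<le> c"
        using IH(1,2) g \<open>x < y\<close> by force+
      ultimately show ?thesis unfolding cs by simp
    qed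
  qed auto
  then show "sorted cs"
    and "\<And>a. a \<in> set xs \<Longrightarrow> Suc (count (mset cs) a) = count (mset xs) a"
    and "\<And>a. a \<notin> set xs \<Longrightarrow> count (mset cs) a \<le> 1" by auto
qed

text \<open>
  Rolle's theorem gives one critical point in each gap between distinct roots, and a root of
  order \<open>m\<close> is a critical point of order \<open>m - 1\<close>; by degree there are no others.
\<close>

lemma pderiv_root_poly:
  fixes xs :: "real list"
  assumes "sorted xs" "xs \<noteq> []"
  defines "cs \<equiv> real_roots (pderiv (root_poly xs))"
  shows "length cs = length xs - 1"
    and "pderiv (root_poly xs) = smult (real (length xs)) (root_poly cs)"
    and "\<And>i. Suc i < length xs \<Longrightarrow> xs ! i \<le> cs ! i \<and> cs ! i \<le> xs ! Suc i"
    and "\<And>i. Suc i < length xs \<Longrightarrow> xs ! i < xs ! Suc i \<Longrightarrow>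
          xs ! i < cs ! i \<and> cs ! i < xs ! Suc i"
proof -
  let ?P = "root_poly xs"
  define P' where "P' = pderiv ?P"
  \<comment> \<open>Between distinct roots this picks a zero of the derivative, which the mean value
    theorem provides.\<close>
  define g where "g a b = (if a = b then a else SOME c. a < c \<and> c < b \<and> poly P' c = 0)" for a b
  have g_same: "g a a = a" for a by (simp add: g_def)
  have g_gap: "a < g a b \<and> g a b < b \<and> poly P' (g a b) = 0"
    if "a \<in> set xs" "b \<in> set xs" "a < b" for a b
  proof -
    have "poly ?P x = 0" if "x \<in> set xs" for x
      using that by (simp add: poly_root_poly prod_list_zero_iff)
    with that obtain c where "a < c" "c < b" "(b - a) * poly P' c = 0"
      using poly_MVT[of a b ?P] unfolding P'_def by auto
    with \<open>a < b\<close> have "\<exists>c. a < c \<and> c < b \<and> poly P' c = 0" by auto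
    from someI_ex[OF this] show ?thesis using \<open>a < b\<close> by (simp add: g_def)
  qed
  define ds where "ds = map2 g xs (tl xs)"
  note props = gap_choice_props[of xs g, OF assms(1) g_same, folded ds_def]
  have len: "length ds = length xs - 1" by (simp add: ds_def)
  have nth: "ds ! i = g (xs ! i) (xs ! Suc i)" if "Suc i < length xs" for i
    using that by (simp add: ds_def nth_tl)
  have degP': "degree P' = length xs - 1" unfolding P'_def by (simp add: degree_pderiv)
  have lcP': "lead_coeff P' = real (length xs)"
    unfolding degP' unfolding P'_def coeff_pderiv using assms(2) by simp
  then have nz: "P' \<noteq> 0" using assms(2) by auto
  \<comment> \<open>At a root of \<open>?P\<close> both sides count its multiplicity minus one.
    Elsewhere \<open>ds\<close> contains a point at most once, and only if it is a zero of
    \<open>P'\<close>.\<close>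
  have "mset ds \<subseteq># proots P'"
  proof (rule mset_subset_eqI)
    fix a
    show "count (mset ds) a \<le> count (proots P') a"
    proof (cases "a \<in> set xs")
      case True
      then have "order a ?P = count (mset xs) a" by (metis count_proots proots_root_poly root_poly_nonzero)
      moreover have "poly ?P a = 0" using True by (simp add: poly_root_poly prod_list_zero_iff)
      ultimately have "count (mset xs) a = Suc (order a P')"
        using order_pderiv[of ?P a] unfolding P'_def by simp
      then show ?thesis using props(2)[OF _ True] g_gap nz by simp
    next
      case False
      show ?thesis
      proof (cases "a \<in> set ds")
        case True
        then obtain i where "i < length ds" "a = ds ! i" by (metis in_set_conv_nth)
        then have i: "Suc i < length xs" "a = g (xs ! i) (xs ! Suc i)"
          using len nth by auto
        have "xs ! i \<le> xs ! Suc i" using assms(1) i(1) by (simp add: sorted_nth_mono)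
        moreover have "xs ! i \<noteq> xs ! Suc i" using i False g_same by (metis Suc_lessD nth_mem)
        ultimately have "poly P' a = 0" using g_gap i by simp
        then have "order a P' \<noteq> 0" using nz by (simp add: order_root)
        then show ?thesis using props(3)[OF _ False] g_gap nz by simp
      next
        case False
        then show ?thesis by (simp add: count_mset_0_iff[THEN iffD2])
      qed
    qed
  qed
  \<comment> \<open>The degree of \<open>P'\<close> leaves room for no further roots, so the
    inclusion is an equality.\<close>
  moreover have "size (proots P') \<le> size (mset ds)"
    using size_proots_le[of P'] degP' len by simp
  ultimately have eq: "mset ds = proots P'"
    by (metis mset_subset_size not_le subset_mset.le_less)
  then have "real_roots P' = ds"
    using props(1) g_gap by (metis real_roots_def sorted_list_of_multiset_mset sorted_sort_id)
  then have cs: "cs = ds" by (simp add: cs_def P'_def)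
  show "length cs = length xs - 1" using cs len by simp
  have "size (proots P') = degree P'" using degP' len eq by (metis size_mset)
  then show "pderiv ?P = smult (real (length xs)) (root_poly cs)"
    using smult_root_poly_real_roots[OF nz] lcP' by (simp add: P'_def cs_def)
  fix i assume i: "Suc i < length xs"
  show *: "xs ! i < cs ! i \<and> cs ! i < xs ! Suc i" if "xs ! i < xs ! Suc i"
    using g_gap[of "xs ! i" "xs ! Suc i"] that i nth cs by simp
  have "xs ! i \<le> xs ! Suc i" using assms(1) i by (simp add: sorted_nth_mono)
  then show "xs ! i \<le> cs ! i \<and> cs ! i \<le> xs ! Suc i"
    using * g_same i nth cs by (cases "xs ! i = xs ! Suc i") auto
qed

abbreviation critical_points :: "real ^ 'n ^ 'n \<Rightarrow> real list" where
  "critical_points A \<equiv> real_roots (pderiv (charpoly A))"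

lemma critical_points_Sym2:
  fixes A :: "real ^ 'n ^ 'n"
  assumes "A \<in> Sym2"
  shows "length (critical_points A) = CARD('n) - 1"
    and "pderiv (charpoly A) = smult (real CARD('n)) (root_poly (critical_points A))"
    and "\<And>i. Suc i < CARD('n) \<Longrightarrow>
      eigenvalues A ! i \<le> critical_points A ! i \<and> critical_points A ! i \<le> eigenvalues A ! Suc i"
proof -
  have "eigenvalues A \<noteq> []" using charpoly_Sym2(2)[OF assms] by force
  note crit = pderiv_root_poly[OF sorted_real_roots this, folded charpoly_Sym2(1)[OF assms],
      unfolded charpoly_Sym2(2)[OF assms]]
  show "length (critical_points A) = CARD('n) - 1"
    and "pderiv (charpoly A) = smult (real CARD('n)) (root_poly (critical_points A))"
    and "\<And>i. Suc i < CARD('n) \<Longrightarrow>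
      eigenvalues A ! i \<le> critical_points A ! i \<and> critical_points A ! i \<le> eigenvalues A ! Suc i"
    by (rule crit(1), rule crit(2), rule crit(3))
qed

text \<open>The characteristic polynomial changes by a constant factor and composition with an
  affine map. By the chain rule so does its derivative, and critical points therefore move exactly
  as eigenvalues do.\<close>

lemma critical_points_affine:
  fixes A :: "real ^ 'n ^ 'n"
  assumes A: "A \<in> Sym2" and t: "t > 0"
  shows "critical_points (t *\<^sub>R (A - e *\<^sub>R mat 1)) = map (\<lambda>x. t * (x - e)) (critical_points A)"
proof -
  let ?B = "t *\<^sub>R (A - e *\<^sub>R mat 1)" and ?n = "CARD('n)"
  note [simp] = charpoly_Sym2(2)[OF A]
  note crit = critical_points_Sym2[OF A]
  have scale: "root_poly (map (\<lambda>x. t * (x - e)) xs) =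
      smult (t ^ length xs) (pcompose (root_poly xs) [:e, 1 / t:])" for xs
    using poly_root_poly_affine[OF t, of e xs]
    by (simp add: poly_eq_poly_eq_iff[symmetric] fun_eq_iff poly_pcompose field_simps)
  have "charpoly ?B = smult (t ^ ?n) (pcompose (charpoly A) [:e, 1 / t:])"
    using charpoly_Sym2[OF Sym2_shift[OF A, of t e]] charpoly_Sym2[OF A] scale[of "eigenvalues A"]
    by (simp add: eigenvalues_affine[OF A t])
  then have "pderiv (charpoly ?B) =
      smult (t ^ ?n / t) (pcompose (pderiv (charpoly A)) [:e, 1 / t:])"
    by (simp add: pderiv_smult pderiv_pcompose pderiv_pCons)
  also have "\<dots> = smult (t ^ ?n / t * ?n / t ^ length (critical_points A))
      (root_poly (map (\<lambda>x. t * (x - e)) (critical_points A)))"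
    using t unfolding scale by (subst crit(2)) (simp add: pcompose_smult)
  finally have "critical_points ?B =
      real_roots (root_poly (map (\<lambda>x. t * (x - e)) (critical_points A)))"
    using t by simp
  also have "\<dots> = map (\<lambda>x. t * (x - e)) (critical_points A)"
    using t by (intro real_roots_root_poly) (simp add: sorted_wrt_map sorted_wrt_mono_rel[of _ "(\<le>)"])
  finally show ?thesis .
qed

section \<open>The \<open>\<sigma>\<^sub>n\<^sub>-\<^sub>1\<close>-eigenvalues as critical
  points\<close>

text \<open>A subset of \<open>{1..n}\<close> with n - 1 elements is the complement of a single
  index. In this form the sum matches the product rule for a polynomial given by its roots.\<close>

lemma sigma_pred_shift:
  fixes A :: "real ^ 'n ^ 'n"
  assumes "A \<in> Sym2"
  shows "sigma (CARD('n) - 1) (t *\<^sub>R mat 1 + A) =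
    (\<Sum>i<CARD('n). \<Prod>j\<in>{..<CARD('n)} - {i}. t + eigenvalues A ! j)"
proof -
  \<comment> \<open>Written with scale 1 and shift \<open>- t\<close>, so that
    \<open>eigenvalues_affine\<close> applies.\<close>
  let ?n = "CARD('n)" and ?B = "1 *\<^sub>R (A - (- t) *\<^sub>R mat 1)"
  have B: "t *\<^sub>R mat 1 + A = ?B" by simp
  have eig: "eigval (Suc j) ?B = t + eigenvalues A ! j" if "j < ?n" for j
    using that charpoly_Sym2(2)[OF assms]
    unfolding eigval_eq_nth eigenvalues_affine[OF assms zero_less_one] by simp
  \<comment> \<open>The map \<open>Suc\<close> translates between list positions, which start at 0,
    and eigenvalue indices, which start at 1.\<close>
  have sets: "{S. S \<subseteq> {1..?n} \<and> card S = ?n - 1} = (\<lambda>i. Suc ` ({..<?n} - {i})) ` {..<?n}"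
  proof (intro equalityI subsetI)
    fix S assume "S \<in> {S. S \<subseteq> {1..?n} \<and> card S = ?n - 1}"
    then have S: "S \<subseteq> {1..?n}" "card S = ?n - 1" by auto
    then have "card ({1..?n} - S) = 1"
      by (subst card_Diff_subset) (auto intro: finite_subset)
    then obtain a where a: "{1..?n} - S = {a}" by (auto simp: card_1_singleton_iff)
    then have "a \<in> {1..?n}" "S = {1..?n} - {a}" using S(1) by auto
    moreover have "{1..?n} = Suc ` {..<?n}" by (simp add: image_Suc_lessThan)
    ultimately show "S \<in> (\<lambda>i. Suc ` ({..<?n} - {i})) ` {..<?n}"
      by (intro image_eqI[of _ _ "a - 1"]) auto
  qed (auto simp: card_image card_Diff_singleton_if)
  have inj: "inj_on (\<lambda>i. Suc ` ({..<?n} - {i})) {..<?n}"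
    by (rule inj_onI) (auto simp: inj_image_eq_iff)
  have "sigma (?n - 1) ?B =
      (\<Sum>i<?n. \<Prod>j\<in>Suc ` ({..<?n} - {i}). eigval j ?B)"
    unfolding sigma_def sets by (subst sum.reindex[OF inj]) simp
  also have "\<dots> = (\<Sum>i<?n. \<Prod>j\<in>{..<?n} - {i}. t + eigenvalues A ! j)"
  proof (rule sum.cong[OF refl])
    fix i
    have "(\<Prod>j\<in>Suc ` ({..<?n} - {i}). eigval j ?B) = (\<Prod>j\<in>{..<?n} - {i}. eigval (Suc j) ?B)"
      by (subst prod.reindex) simp_all
    also have "\<dots> = (\<Prod>j\<in>{..<?n} - {i}. t + eigenvalues A ! j)"
      by (intro prod.cong refl eig) auto
    finally show "(\<Prod>j\<in>Suc ` ({..<?n} - {i}). eigval j ?B) =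
      (\<Prod>j\<in>{..<?n} - {i}. t + eigenvalues A ! j)" .
  qed
  finally show ?thesis unfolding B .
qed

lemma poly_pderiv_root_poly:
  "poly (pderiv (root_poly xs)) t = (\<Sum>i<length xs. \<Prod>j\<in>{..<length xs} - {i}. t - xs ! j)"
proof -
  have "root_poly xs = (\<Prod>i<length xs. [:- xs ! i, 1:])"
    unfolding root_poly_def by (simp add: prod.list_conv_set_nth atLeast0LessThan)
  then show ?thesis
    by (simp add: pderiv_prod poly_sum poly_prod pderiv_pCons)
qed

text \<open>With p the characteristic polynomial,
  \<open>\<sigma>\<^sub>n\<^sub>-\<^sub>1(tI + A)\<close> is the derivative of p at
  \<open>- t\<close>, up to the sign \<open>(- 1) ^ (n - 1)\<close>. Its roots are the negated
  critical points, and the negation in \<open>sigma_eigval\<close> undoes this.\<close>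

lemma sigma_eigval_eq_nth:
  fixes A :: "real ^ 'n ^ 'n"
  assumes A: "A \<in> Sym2"
  shows "sigma_eigval (CARD('n) - 1) k A = critical_points A ! (k - 1)"
proof -
  let ?n = "CARD('n)" and ?neg = "map uminus (critical_points A)"
  note crit = critical_points_Sym2[OF A]
  define q where "q = smult (real ?n) (root_poly ?neg)"
  have "poly q t = sigma (?n - 1) (t *\<^sub>R mat 1 + A)" for t
  proof -
    have len: "length (critical_points A) = ?n - 1" by (rule crit(1))
    have "poly (root_poly (map uminus xs)) t = (- 1) ^ length xs * poly (root_poly xs) (- t)" for xs
      by (induction xs) (simp_all add: algebra_simps)
    from this[of "critical_points A"] len
    have "poly (root_poly ?neg) t = (- 1) ^ (?n - 1) * poly (root_poly (critical_points A)) (- t)"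
      by simp
    then have "poly q t = (- 1) ^ (?n - 1) * poly (pderiv (charpoly A)) (- t)"
      unfolding q_def by (subst crit(2)) simp
    also have "\<dots> = (\<Sum>i<?n. (- 1) ^ (?n - 1) * (\<Prod>j\<in>{..<?n} - {i}. - t - eigenvalues A ! j))"
      using poly_pderiv_root_poly[of "eigenvalues A" "- t"]
      unfolding charpoly_Sym2(1)[OF A, symmetric] charpoly_Sym2(2)[OF A] by (simp add: sum_distrib_left)
    \<comment> \<open>Each product has n - 1 factors, so the sign in front flips every one of
      them.\<close>
    also have "\<dots> = (\<Sum>i<?n. \<Prod>j\<in>{..<?n} - {i}. t + eigenvalues A ! j)"
    proof (rule sum.cong[OF refl])
      fix i assume "i \<in> {..<?n}"
      then have "card ({..<?n} - {i}) = ?n - 1" by simp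
      then have "(- 1) ^ (?n - 1) * (\<Prod>j\<in>{..<?n} - {i}. - t - eigenvalues A ! j) =
          (\<Prod>j\<in>{..<?n} - {i}. - 1) * (\<Prod>j\<in>{..<?n} - {i}. - t - eigenvalues A ! j)"
        by (metis prod_constant)
      also have "\<dots> = (\<Prod>j\<in>{..<?n} - {i}. t + eigenvalues A ! j)"
        by (simp add: prod.distrib[symmetric] add.commute del: prod_constant)
      finally show "(- 1) ^ (?n - 1) * (\<Prod>j\<in>{..<?n} - {i}. - t - eigenvalues A ! j) =
          (\<Prod>j\<in>{..<?n} - {i}. t + eigenvalues A ! j)" .
    qed
    also have "\<dots> = sigma (?n - 1) (t *\<^sub>R mat 1 + A)" using sigma_pred_shift[OF A] by simp
    finally show ?thesis .
  qed
  then have "sigma_poly (?n - 1) A = q"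
    unfolding sigma_poly_def by (intro the_equality) (auto simp: poly_eq_poly_eq_iff[symmetric])
  then have "image_mset uminus (proots (sigma_poly (?n - 1) A)) = mset (critical_points A)"
    by (simp add: q_def multiset.map_comp o_def)
  then show ?thesis
    by (simp add: sigma_eigval_def real_roots_def)
qed

section \<open>Asymptotics of sums of arctangents\<close>

lemma tendsto_arctan_scaled:
  "((\<lambda>t. arctan (t * y)) \<longlongrightarrow> sgn y * (pi / 2)) at_top"
proof -
  consider "y > 0" | "y < 0" | "y = 0" by linarith
  then show ?thesis
  proof cases
    case 1
    have "filterlim (\<lambda>t. t * y) at_top at_top"
      using 1 by (intro filterlim_at_top_mult_tendsto_pos[OF tendsto_const] filterlim_ident)
    from filterlim_compose[OF tendsto_arctan_at_top this] show ?thesis using 1 by simp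
  next
    case 2
    have "filterlim (\<lambda>t. t * y) at_bot at_top"
      using 2 filterlim_tendsto_neg_mult_at_bot[OF tendsto_const[of y], of "\<lambda>t. t" at_top]
      by (simp add: filterlim_ident mult.commute)
    from filterlim_compose[OF tendsto_arctan_at_bot this] show ?thesis using 2 by simp
  qed simp
qed

text \<open>The derivative of \<open>arctan\<close> at 0 is 1, so \<open>arctan u / u\<close> tends
  to 1. Here \<open>u = 1 / (t * y)\<close>, which tends to 0 without vanishing.\<close>

lemma tendsto_scaled_arctan_inverse:
  fixes y :: real
  assumes "y \<noteq> 0"
  shows "((\<lambda>t. t * arctan (1 / (t * y))) \<longlongrightarrow> 1 / y) at_top"
proof -
  have d: "((\<lambda>u. arctan u / u) \<longlongrightarrow> 1) (at 0)"
    using DERIV_arctan[of 0] by (simp add: DERIV_def)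
  have "((\<lambda>t. inverse t * (1 / y)) \<longlongrightarrow> 0 * (1 / y)) at_top"
    by (intro tendsto_intros tendsto_inverse_0_at_top filterlim_ident)
  then have "((\<lambda>t. 1 / (t * y)) \<longlongrightarrow> 0) at_top"
    by (simp add: field_simps)
  then have "filterlim (\<lambda>t. 1 / (t * y)) (at 0) at_top"
    using assms eventually_gt_at_top[of 0]
    by (intro filterlim_atI) (auto elim!: eventually_mono)
  from filterlim_compose[OF d this]
  have "((\<lambda>t. arctan (1 / (t * y)) / (1 / (t * y)) * (1 / y)) \<longlongrightarrow> 1 * (1 / y)) at_top"
    by (intro tendsto_mult tendsto_const)
  then show ?thesis using assms by (simp add: mult.commute)
qed

text \<open>The reference sign pattern, k times -1 and then +1, against which the following sign
  sums are compared term by term.\<close>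

lemma sum_signs_split: "k \<le> n \<Longrightarrow> (\<Sum>i<n. if i < k then - 1 else 1 :: real) = real n - 2 * real k"
  by (induction n rule: dec_induct) simp_all

lemma sum_sgn_ge:
  fixes y :: "nat \<Rightarrow> real"
  assumes "k \<le> n" and "\<And>i. k \<le> i \<Longrightarrow> i < n \<Longrightarrow> y i > 0"
  shows "real n - 2 * real k \<le> (\<Sum>i<n. sgn (y i))"
  unfolding sum_signs_split[OF assms(1), symmetric]
  using assms(2) by (intro sum_mono) (auto simp: sgn_real_def)

lemma sum_sgn_le:
  fixes y :: "nat \<Rightarrow> real"
  assumes "k \<le> n" and "\<And>i. i < k \<Longrightarrow> y i < 0"
  shows "(\<Sum>i<n. sgn (y i)) \<le> real n - 2 * real k"
  unfolding sum_signs_split[OF assms(1), symmetric]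
  by (intro sum_mono) (auto simp: sgn_real_def dest!: assms(2))

lemma sum_sgn_less:
  fixes y :: "nat \<Rightarrow> real"
  assumes "k < n" and "\<And>i. i < k \<Longrightarrow> y i < 0" and "y k \<le> 0"
  shows "(\<Sum>i<n. sgn (y i)) < real n - 2 * real k"
proof -
  have "(\<Sum>i<n. sgn (y i)) < (\<Sum>i<n. if i < k then - 1 else 1)"
    using assms(1,3)
    by (intro sum_strict_mono_ex1) (auto simp: sgn_real_def intro!: bexI[of _ k] dest!: assms(2))
  then show ?thesis using sum_signs_split[of k n] assms(1) by simp
qed

lemma tendsto_sum_arctan:
  fixes y :: "nat \<Rightarrow> real"
  shows "((\<lambda>t. \<Sum>i<n. arctan (t * y i)) \<longlongrightarrow> (\<Sum>i<n. sgn (y i)) * (pi / 2)) at_top"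
  unfolding sum_distrib_right by (intro tendsto_sum tendsto_arctan_scaled)

text \<open>Here the sum of arctangents tends to exactly the threshold, so the limit alone cannot
  decide the inequality. The identity for \<open>arctan (1 / x)\<close> turns the excess into a sum
  of \<open>arctan (1 / (t * y i))\<close>, which is of order \<open>1 / t\<close>.\<close>

lemma tendsto_sum_arctan_excess:
  fixes y :: "nat \<Rightarrow> real"
  assumes "k \<le> n" and neg: "\<And>i. i < k \<Longrightarrow> y i < 0" and pos: "\<And>i. k \<le> i \<Longrightarrow> i < n \<Longrightarrow> y i > 0"
  shows "((\<lambda>t. t * ((real n - 2 * real k) * (pi / 2) - (\<Sum>i<n. arctan (t * y i))))
    \<longlongrightarrow> (\<Sum>i<n. 1 / y i)) at_top"
proof -
  have sgn: "(\<Sum>i<n. sgn (y i)) = real n - 2 * real k"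
    using sum_sgn_ge[of k n y] sum_sgn_le[of k n y] assms by fastforce
  have nz: "y i \<noteq> 0" if "i < n" for i
    using neg[of i] pos[of i] that by (cases "i < k") auto
  have "((\<lambda>t. \<Sum>i<n. t * arctan (1 / (t * y i))) \<longlongrightarrow> (\<Sum>i<n. 1 / y i)) at_top"
    using nz by (intro tendsto_sum tendsto_scaled_arctan_inverse) auto
  moreover have "\<forall>\<^sub>F t in at_top. (\<Sum>i<n. t * arctan (1 / (t * y i))) =
      t * ((real n - 2 * real k) * (pi / 2) - (\<Sum>i<n. arctan (t * y i)))"
    using eventually_gt_at_top[of 0]
  proof eventually_elim
    case (elim t)
    have "arctan (1 / (t * y i)) = sgn (y i) * (pi / 2) - arctan (t * y i)" if "i < n" for i
    proof -
      have "arctan (1 / (t * y i)) = sgn (t * y i) * pi / 2 - arctan (t * y i)"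
        using nz[OF that] elim by (intro Transcendental.arctan_inverse) simp
      also have "sgn (t * y i) = sgn (y i)" using elim by (simp add: sgn_mult)
      finally show ?thesis by simp
    qed
    then have "(\<Sum>i<n. arctan (1 / (t * y i))) =
        (\<Sum>i<n. sgn (y i)) * (pi / 2) - (\<Sum>i<n. arctan (t * y i))"
      by (simp add: sum_subtractf sum_distrib_right)
    then show ?case by (simp add: sum_distrib_left[symmetric] sgn)
  qed
  ultimately show ?thesis by (rule Lim_transform_eventually)
qed

text \<open>
  The logarithmic derivative of the root polynomial is strictly decreasing on a gap between
  roots and vanishes at the critical point \<open>cs ! j\<close>.
\<close>

lemma sum_inverse_gap:
  fixes xs :: "real list"
  assumes xs: "sorted xs" "Suc j < length xs" and gap: "xs ! j < e" "e < xs ! Suc j"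
  defines "cs \<equiv> real_roots (pderiv (root_poly xs))"
  shows "e < cs ! j \<Longrightarrow> (\<Sum>i<length xs. 1 / (xs ! i - e)) < 0"
    and "cs ! j < e \<Longrightarrow> (\<Sum>i<length xs. 1 / (xs ! i - e)) > 0"
proof -
  let ?n = "length xs" and ?P = "root_poly xs" and ?c = "cs ! j"
  have ne: "xs \<noteq> []" using xs(2) by auto
  note crit = pderiv_root_poly[OF xs(1) ne, folded cs_def]
  have c: "xs ! j < ?c" "?c < xs ! Suc j" using crit(4)[of j] xs(2) gap by auto
  have side: "xs ! i \<le> xs ! j \<or> xs ! Suc j \<le> xs ! i" if "i < ?n" for i
    using that xs by (cases "i \<le> j") (auto intro!: sorted_nth_mono)
  have nz: "?c - xs ! i \<noteq> 0" if "i < ?n" for i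
    using side[OF that] c by auto
  have "pderiv ?P \<noteq> 0" using crit(2) ne by simp
  moreover have "?c \<in> set cs" using crit(1) xs(2) by (intro nth_mem) auto
  ultimately have "0 = poly (pderiv ?P) ?c" unfolding cs_def by (simp add: set_real_roots)
  \<comment> \<open>Since \<open>?c\<close> is not a root, each term of the product rule is the full
    product divided by one factor.\<close>
  also have "\<dots> = (\<Sum>i<?n. poly ?P ?c * (1 / (?c - xs ! i)))"
    unfolding poly_pderiv_root_poly poly_root_poly_nth
    by (intro sum.cong refl) (use nz in \<open>auto simp: prod.remove\<close>)
  also have "\<dots> = poly ?P ?c * (\<Sum>i<?n. 1 / (?c - xs ! i))"
    by (rule sum_distrib_left[symmetric])
  finally have "(\<Sum>i<?n. 1 / (?c - xs ! i)) = 0"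
    using nz by (auto simp: poly_root_poly_nth)
  moreover have "(\<Sum>i<?n. 1 / (xs ! i - ?c)) = - (\<Sum>i<?n. 1 / (?c - xs ! i))"
    by (simp add: sum_negf[symmetric] minus_divide_right)
  ultimately have zero: "(\<Sum>i<?n. 1 / (xs ! i - ?c)) = 0" by simp
  \<comment> \<open>Both \<open>e\<close> and \<open>?c\<close> lie in the same open gap, so every
    root lies on the same side of both and the denominator is positive. The sign of each difference
    is then that of \<open>e - ?c\<close>.\<close>
  have diff: "1 / (xs ! i - e) - 1 / (xs ! i - ?c) = (e - ?c) / ((xs ! i - e) * (xs ! i - ?c))"
    and pos: "(xs ! i - e) * (xs ! i - ?c) > 0" if "i < ?n" for i
  proof -
    show *: "(xs ! i - e) * (xs ! i - ?c) > 0"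
      using side[OF that] c gap by (auto intro: mult_neg_neg mult_pos_pos)
    then have "xs ! i - e \<noteq> 0" "xs ! i - ?c \<noteq> 0" by auto
    then show "1 / (xs ! i - e) - 1 / (xs ! i - ?c) = (e - ?c) / ((xs ! i - e) * (xs ! i - ?c))"
      by (simp add: diff_frac_eq)
  qed
  have nonempty: "{..<?n} \<noteq> {}" using xs(2) by auto
  show "(\<Sum>i<?n. 1 / (xs ! i - e)) < 0" if "e < ?c"
  proof -
    have "(\<Sum>i<?n. 1 / (xs ! i - e)) < (\<Sum>i<?n. 1 / (xs ! i - ?c))"
    proof (rule sum_strict_mono)
      fix i assume "i \<in> {..<?n}"
      then have i: "i < ?n" by simp
      show "1 / (xs ! i - e) < 1 / (xs ! i - ?c)"
        using diff[OF i] divide_neg_pos[OF _ pos[OF i], of "e - ?c"] that by linarith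
    qed (use nonempty in auto)
    with zero show ?thesis by simp
  qed
  show "(\<Sum>i<?n. 1 / (xs ! i - e)) > 0" if "?c < e"
  proof -
    have "(\<Sum>i<?n. 1 / (xs ! i - e)) > (\<Sum>i<?n. 1 / (xs ! i - ?c))"
    proof (rule sum_strict_mono)
      fix i assume "i \<in> {..<?n}"
      then have i: "i < ?n" by simp
      show "1 / (xs ! i - ?c) < 1 / (xs ! i - e)"
        using diff[OF i] divide_pos_pos[OF _ pos[OF i], of "e - ?c"] that by linarith
    qed (use nonempty in auto)
    with zero show ?thesis by simp
  qed
qed

section \<open>The asymptotic interiors\<close>

lemma tr_arctan_affine:
  fixes A :: "real ^ 'n ^ 'n"
  assumes "A \<in> Sym2" "t > 0"
  shows "tr_arctan (t *\<^sub>R (A - e *\<^sub>R mat 1)) =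
    (\<Sum>i<CARD('n). arctan (t * (eigenvalues A ! i - e)))"
proof -
  have "tr_arctan (t *\<^sub>R (A - e *\<^sub>R mat 1)) =
      (\<Sum>i<CARD('n). arctan (eigval (Suc i) (t *\<^sub>R (A - e *\<^sub>R mat 1))))"
    unfolding tr_arctan_def
    by (simp add: sum.atLeast1_atMost_eq)
  also have "\<dots> = (\<Sum>i<CARD('n). arctan (t * (eigenvalues A ! i - e)))"
    using charpoly_Sym2(2)[OF assms(1)] by (simp add: eigval_eq_nth eigenvalues_affine[OF assms])
  finally show ?thesis .
qed

text \<open>Membership concerns large \<open>t\<close> only, so \<open>t\<close> may be taken
  positive and the eigenvalue formula for \<open>t *\<^sub>R (A - e *\<^sub>R mat 1)\<close>
  used.\<close>

lemma asymptotic_interior_F_arctan: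
  "asymptotic_interior (F_arctan \<theta> :: (real ^ 'n ^ 'n) set) =
    {A \<in> Sym2. \<exists>e>0. \<forall>\<^sub>F t in at_top. \<theta> \<le> (\<Sum>i<CARD('n). arctan (t * (eigenvalues A ! i - e)))}"
proof -
  have "(\<exists>t0. \<forall>t\<ge>t0. t *\<^sub>R (A - e *\<^sub>R mat 1) \<in> F_arctan \<theta>) \<longleftrightarrow>
      (\<forall>\<^sub>F t in at_top. \<theta> \<le> (\<Sum>i<CARD('n). arctan (t * (eigenvalues A ! i - e))))"
    if "A \<in> Sym2" for A :: "real ^ 'n ^ 'n" and e
  proof -
    have "\<forall>\<^sub>F t in at_top. t *\<^sub>R (A - e *\<^sub>R mat 1) \<in> F_arctan \<theta> \<longleftrightarrow>
        \<theta> \<le> (\<Sum>i<CARD('n). arctan (t * (eigenvalues A ! i - e)))"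
      using eventually_gt_at_top[of 0]
      by eventually_elim (use that in \<open>simp add: F_arctan_def Sym2_shift tr_arctan_affine\<close>)
    then show ?thesis
      unfolding eventually_at_top_linorder[symmetric] by (rule eventually_subst)
  qed
  then show ?thesis unfolding asymptotic_interior_def by auto
qed

lemma eventually_le_sum_arctan:
  fixes y :: "nat \<Rightarrow> real"
  assumes "\<theta> < (\<Sum>i<n. sgn (y i)) * (pi / 2)"
  shows "\<forall>\<^sub>F t in at_top. \<theta> \<le> (\<Sum>i<n. arctan (t * y i))"
  using order_tendstoD(1)[OF tendsto_sum_arctan assms] by eventually_elim simp

lemma not_eventually_le_sum_arctan:
  fixes y :: "nat \<Rightarrow> real"
  assumes "(\<Sum>i<n. sgn (y i)) * (pi / 2) < \<theta>"
  shows "\<not> (\<forall>\<^sub>F t in at_top. \<theta> \<le> (\<Sum>i<n. arctan (t * y i)))"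
proof
  assume "\<forall>\<^sub>F t in at_top. \<theta> \<le> (\<Sum>i<n. arctan (t * y i))"
  with order_tendstoD(2)[OF tendsto_sum_arctan assms] have "\<forall>\<^sub>F t :: real in at_top. False"
    by eventually_elim simp
  then show False by (simp add: trivial_limit_at_top_linorder)
qed

text \<open>The signature of \<open>A - e I\<close> is at least n - 2(k - 1) for small
  \<open>e\<close> if \<open>\<lambda>\<^sub>k > 0\<close>, and at most n - 2k for every
  \<open>e > 0\<close> otherwise. Both bounds are strictly separated by \<open>\<theta>\<close>, so
  the limits decide.\<close>

lemma asymptotic_interior_generic:
  assumes k: "k \<in> {1..CARD('n)}"
    and \<theta>: "\<theta> \<in> {(real CARD('n) - 2 * real k) * (pi / 2) <..<
                  (real CARD('n) - 2 * (real k - 1)) * (pi / 2)}"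
  shows "asymptotic_interior (F_arctan \<theta> :: (real ^ 'n ^ 'n) set) = {A \<in> Sym2. eigval k A > 0}"
proof -
  let ?n = "CARD('n)"
  have "(\<exists>e>0. \<forall>\<^sub>F t in at_top. \<theta> \<le> (\<Sum>i<?n. arctan (t * (eigenvalues A ! i - e)))) \<longleftrightarrow>
      eigval k A > 0" (is "?L \<longleftrightarrow> ?R") if A: "A \<in> Sym2" for A :: "real ^ 'n ^ 'n"
  proof
    let ?x = "eigenvalues A"
    note len = charpoly_Sym2(2)[OF A]
    assume ?R
    \<comment> \<open>Any shift strictly between 0 and the k-th eigenvalue would do.\<close>
    define e where "e = eigval k A / 2"
    have "?x ! i - e > 0" if "k - 1 \<le> i" "i < ?n" for i
      using sorted_nth_mono[OF sorted_real_roots that(1), of "charpoly A"] that len \<open>?R\<close>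
      unfolding e_def eigval_eq_nth by auto
    then have "real ?n - 2 * real (k - 1) \<le> (\<Sum>i<?n. sgn (?x ! i - e))"
      using k by (intro sum_sgn_ge) auto
    then have "real ?n - 2 * (real k - 1) \<le> (\<Sum>i<?n. sgn (?x ! i - e))"
      using k by (simp add: of_nat_diff)
    then have "(real ?n - 2 * (real k - 1)) * (pi / 2) \<le> (\<Sum>i<?n. sgn (?x ! i - e)) * (pi / 2)"
      by (intro mult_right_mono) auto
    with \<theta> have "\<theta> < (\<Sum>i<?n. sgn (?x ! i - e)) * (pi / 2)"
      unfolding greaterThanLessThan_iff by linarith
    then show ?L using \<open>?R\<close> eventually_le_sum_arctan[of \<theta> "\<lambda>i. ?x ! i - e" ?n]
      by (intro exI[of _ e]) (simp add: e_def)
  next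
    let ?x = "eigenvalues A"
    note len = charpoly_Sym2(2)[OF A]
    assume ?L
    then obtain e where e: "e > 0"
      "\<forall>\<^sub>F t in at_top. \<theta> \<le> (\<Sum>i<?n. arctan (t * (eigenvalues A ! i - e)))" by blast
    show ?R
    proof (rule ccontr)
      assume "\<not> ?R"
      \<comment> \<open>The first k eigenvalues are at most the k-th, hence nonpositive, and any
        positive shift makes them strictly negative.\<close>
      have "?x ! i \<le> ?x ! (k - 1)" if "i < k" for i
        using that len k by (intro sorted_nth_mono[OF sorted_real_roots]) auto
      with e \<open>\<not> ?R\<close> have "?x ! i - e < 0" if "i < k" for i
        using that unfolding eigval_eq_nth by fastforce
      then have "(\<Sum>i<?n. sgn (?x ! i - e)) \<le> real ?n - 2 * real k"
        using k by (intro sum_sgn_le) auto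
      then have "(\<Sum>i<?n. sgn (?x ! i - e)) * (pi / 2) \<le> (real ?n - 2 * real k) * (pi / 2)"
        by (intro mult_right_mono) auto
      with \<theta> have "(\<Sum>i<?n. sgn (?x ! i - e)) * (pi / 2) < \<theta>"
        unfolding greaterThanLessThan_iff by linarith
      with not_eventually_le_sum_arctan[of "\<lambda>i. ?x ! i - e" ?n] e show False by blast
    qed
  qed
  then show ?thesis unfolding asymptotic_interior_F_arctan by auto
qed

text \<open>Away from the gap between \<open>\<lambda>\<^sub>k\<close> and
  \<open>\<lambda>\<^sub>k\<^sub>+\<^sub>1\<close> the signature still decides. Inside it the limit
  equals \<open>\<theta>\<close>, and the sign of the \<open>1 / t\<close> term decides according to
  the side of the critical point on which \<open>e\<close> lies.\<close>

lemma asymptotic_interior_critical: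
  assumes k: "k \<in> {1..CARD('n) - 1}" and \<theta>: "\<theta> = (real CARD('n) - 2 * real k) * (pi / 2)"
  shows "asymptotic_interior (F_arctan \<theta> :: (real ^ 'n ^ 'n) set) =
    {A \<in> Sym2. sigma_eigval (CARD('n) - 1) k A > 0}"
proof -
  let ?n = "CARD('n)"
  have kn: "k < ?n" using k unfolding atLeastAtMost_iff by linarith
  have "(\<exists>e>0. \<forall>\<^sub>F t in at_top. \<theta> \<le> (\<Sum>i<?n. arctan (t * (eigenvalues A ! i - e)))) \<longleftrightarrow>
      sigma_eigval (?n - 1) k A > 0" (is "?L \<longleftrightarrow> ?R") if A: "A \<in> Sym2" for A :: "real ^ 'n ^ 'n"
  proof -
    define x where "x = eigenvalues A"
    define c where "c = critical_points A ! (k - 1)"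
    have len: "length x = ?n" and sorted: "sorted x"
      unfolding x_def by (simp_all add: charpoly_Sym2(2)[OF A])
    have R: "?R \<longleftrightarrow> c > 0" unfolding c_def sigma_eigval_eq_nth[OF A] ..
    have c: "c = real_roots (pderiv (root_poly x)) ! (k - 1)"
      unfolding c_def x_def by (simp flip: charpoly_Sym2(1)[OF A])
    have ne: "x \<noteq> []" using len by force
    \<comment> \<open>As lists start at 0, \<open>x ! (k - 1)\<close> and \<open>x ! k\<close> are
      the k-th and the (k + 1)-st eigenvalue.\<close>
    have bounds: "x ! (k - 1) \<le> c" "c \<le> x ! k"
      using pderiv_root_poly(3)[OF sorted ne, of "k - 1"] k len c by auto
    have below: "x ! i \<le> x ! (k - 1)" if "i < k" for i
      using that k len by (intro sorted_nth_mono[OF sorted]) auto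
    have above: "x ! k \<le> x ! i" if "k \<le> i" "i < ?n" for i
      using that len by (intro sorted_nth_mono[OF sorted]) auto
    have lim: "((\<lambda>t. t * (\<theta> - (\<Sum>i<?n. arctan (t * (x ! i - e)))))
        \<longlongrightarrow> (\<Sum>i<?n. 1 / (x ! i - e))) at_top" if "x ! (k - 1) < e" "e < x ! k" for e
      unfolding \<theta>
    proof (intro tendsto_sum_arctan_excess)
      show "k \<le> ?n" using k by auto
    next
      fix i assume "i < k"
      with below[OF this] that show "x ! i - e < 0" by simp
    next
      fix i assume "k \<le> i" "i < ?n"
      with above[OF this] that show "x ! i - e > 0" by simp
    qed
    note gap = sum_inverse_gap[OF sorted, of "k - 1", folded c]
    have "?L \<longleftrightarrow> c > 0"
    proof
      assume "c > 0"
      \<comment> \<open>The shift must avoid the finitely many eigenvalues, so that it is never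
        equal to the left end of the gap.\<close>
      have "infinite ({0<..<c} - set x)" using \<open>c > 0\<close> by (simp add: Diff_infinite_finite)
      then have "{0<..<c} - set x \<noteq> {}" by (rule infinite_imp_nonempty)
      then obtain e where "e \<in> {0<..<c} - set x" by blast
      then have e: "0 < e" "e < c" "e \<notin> set x" by auto
      moreover have "x ! (k - 1) \<in> set x" using k len by (intro nth_mem) auto
      ultimately have "x ! (k - 1) \<noteq> e" by auto
      then consider "e < x ! (k - 1)" | "x ! (k - 1) < e" by linarith
      then have "\<forall>\<^sub>F t in at_top. \<theta> \<le> (\<Sum>i<?n. arctan (t * (x ! i - e)))"
      proof cases
        case 1
        then have "x ! i - e > 0" if "k - 1 \<le> i" "i < ?n" for i
          using sorted_nth_mono[OF sorted that(1)] that len by simp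
        then have "real ?n - 2 * real (k - 1) \<le> (\<Sum>i<?n. sgn (x ! i - e))"
          using k by (intro sum_sgn_ge) auto
        then have "real ?n - 2 * real k < (\<Sum>i<?n. sgn (x ! i - e))"
          using k by (simp add: of_nat_diff)
        then have "\<theta> < (\<Sum>i<?n. sgn (x ! i - e)) * (pi / 2)"
          unfolding \<theta> by (intro mult_strict_right_mono) auto
        then show ?thesis by (rule eventually_le_sum_arctan)
      next
        case 2
        have "e < x ! k" using e bounds by simp
        \<comment> \<open>A negative limit of \<open>t\<close> times the excess means that the trace
          eventually exceeds \<open>\<theta>\<close>.\<close>
        then have "(\<Sum>i<?n. 1 / (x ! i - e)) < 0" using gap(1)[of e] 2 e k kn len by simp
        from order_tendstoD(2)[OF lim[OF 2 \<open>e < x ! k\<close>] this] eventually_gt_at_top[of 0]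
        show ?thesis by eventually_elim (auto simp: mult_less_0_iff)
      qed
      with e show ?L unfolding x_def by blast
    next
      assume ?L
      then obtain e where e: "e > 0" and
        ev: "\<forall>\<^sub>F t in at_top. \<theta> \<le> (\<Sum>i<?n. arctan (t * (x ! i - e)))" unfolding x_def by blast
      show "c > 0"
      proof (rule ccontr)
        assume "\<not> c > 0"
        with e have "c < e" by simp
        with bounds have lt: "x ! (k - 1) < e" by simp
        show False
        proof (cases "e < x ! k")
          case True
          \<comment> \<open>Now the trace stays eventually below \<open>\<theta>\<close>, against
            the choice of \<open>e\<close>.\<close>
          have "(\<Sum>i<?n. 1 / (x ! i - e)) > 0" using gap(2)[of e] lt True \<open>c < e\<close> k kn len by simp
          from order_tendstoD(1)[OF lim[OF lt True] this] eventually_gt_at_top[of 0] ev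
          have "\<forall>\<^sub>F t :: real in at_top. False"
            by eventually_elim (auto simp: zero_less_mult_iff)
          then show False by (simp add: trivial_limit_at_top_linorder)
        next
          case False
          have "x ! i - e < 0" if "i < k" for i using below[OF that] lt by simp
          \<comment> \<open>Besides the k negative terms, the term at position \<open>k\<close> is
            at most 0 instead of 1, which makes the bound strict.\<close>
          then have "(\<Sum>i<?n. sgn (x ! i - e)) < real ?n - 2 * real k"
            using False kn by (intro sum_sgn_less) auto
          then have "(\<Sum>i<?n. sgn (x ! i - e)) * (pi / 2) < \<theta>"
            unfolding \<theta> by (intro mult_strict_right_mono) auto
          with not_eventually_le_sum_arctan[of "\<lambda>i. x ! i - e" ?n] ev show False by blast
        qed
      qed
    qed
    with R show ?thesis by simp
  qed
  then show ?thesis unfolding asymptotic_interior_F_arctan by auto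
qed

section \<open>Limits of root lists\<close>

text \<open>Bolzano-Weierstrass, applied to one coordinate after another; convergence of the earlier
  coordinates survives each further extraction.\<close>

lemma bounded_family_convergent_subseq:
  fixes r :: "nat \<Rightarrow> nat \<Rightarrow> real"
  assumes "\<And>m i. i < d \<Longrightarrow> \<bar>r m i\<bar> \<le> B"
  shows "\<exists>\<phi> y. strict_mono \<phi> \<and> (\<forall>i<d. (\<lambda>m. r (\<phi> m) i) \<longlonglongrightarrow> y i)"
  using assms
proof (induction d)
  case 0
  show ?case by (auto simp: strict_mono_def intro!: exI[of _ id])
next
  case (Suc d)
  have "\<exists>\<phi> y. strict_mono \<phi> \<and> (\<forall>i<d. (\<lambda>m. r (\<phi> m) i) \<longlonglongrightarrow> y i)"
    by (rule Suc.IH) (simp add: Suc.prems)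
  then obtain \<phi> y where \<phi>: "strict_mono \<phi>" "\<And>i. i < d \<Longrightarrow> (\<lambda>m. r (\<phi> m) i) \<longlonglongrightarrow> y i"
    by blast
  have "bounded (range (\<lambda>m. r (\<phi> m) d))"
    using Suc.prems[of d] by (intro boundedI[of _ B]) auto
  then obtain l \<psi> where \<psi>: "strict_mono \<psi>" "((\<lambda>m. r (\<phi> m) d) \<circ> \<psi>) \<longlonglongrightarrow> l"
    using bounded_imp_convergent_subsequence by blast
  have "(\<lambda>m. r ((\<phi> \<circ> \<psi>) m) i) \<longlonglongrightarrow> (y(d := l)) i" if "i < Suc d" for i
  proof (cases "i = d")
    case True
    then show ?thesis using \<psi>(2) by (simp add: o_def)
  next
    case False
    with that have "i < d" by simp
    from LIMSEQ_subseq_LIMSEQ[OF \<phi>(2)[OF this] \<psi>(1)] False show ?thesis by (simp add: o_def)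
  qed
  then show ?case
    using strict_mono_o[OF \<phi>(1) \<psi>(1)]
    by (intro exI[of _ "\<phi> \<circ> \<psi>"] exI[of _ "y(d := l)"]) blast
qed

text \<open>Compactness gives a convergent subsequence of the root tuples. Its limit is sorted and
  has the same polynomial as \<open>ys\<close>, so it is \<open>ys\<close>.\<close>

lemma tendsto_roots_subseq:
  fixes xs :: "nat \<Rightarrow> real list"
  assumes len: "\<And>m. length (xs m) = length ys" and sorted: "\<And>m. sorted (xs m)" "sorted ys"
    and bound: "\<And>m i. i < length ys \<Longrightarrow> \<bar>xs m ! i\<bar> \<le> B"
    and lim: "\<And>t. (\<lambda>m. poly (root_poly (xs m)) t) \<longlonglongrightarrow> poly (root_poly ys) t"
  shows "\<exists>\<phi>. strict_mono \<phi> \<and> (\<forall>i<length ys. (\<lambda>m. xs (\<phi> m) ! i) \<longlonglongrightarrow> ys ! i)"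
proof -
  obtain \<phi> y where \<phi>: "strict_mono \<phi>" "\<And>i. i < length ys \<Longrightarrow> (\<lambda>m. xs (\<phi> m) ! i) \<longlonglongrightarrow> y i"
    using bounded_family_convergent_subseq[of "length ys" "\<lambda>m i. xs m ! i", OF bound] by blast
  define zs where "zs = map y [0..<length ys]"
  have "sorted zs"
    unfolding sorted_iff_nth_mono
  proof (intro allI impI)
    fix i j assume "i \<le> j" "j < length zs"
    then have ij: "i < length ys" "j < length ys" by (simp_all add: zs_def)
    have "xs (\<phi> m) ! i \<le> xs (\<phi> m) ! j" for m
      using sorted_nth_mono[OF sorted(1) \<open>i \<le> j\<close>] ij(2) unfolding len .
    then have "y i \<le> y j"
      by (intro LIMSEQ_le[OF \<phi>(2)[OF ij(1)] \<phi>(2)[OF ij(2)]]) blast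
    then show "zs ! i \<le> zs ! j" using ij by (simp add: zs_def)
  qed
  have "poly (root_poly zs) t = poly (root_poly ys) t" for t
  proof (rule LIMSEQ_unique)
    show "(\<lambda>m. poly (root_poly (xs (\<phi> m))) t) \<longlonglongrightarrow> poly (root_poly zs) t"
      unfolding poly_root_poly_nth len zs_def length_map length_upt diff_zero
      using \<phi>(2) by (intro tendsto_prod tendsto_diff tendsto_const) simp
    show "(\<lambda>m. poly (root_poly (xs (\<phi> m))) t) \<longlonglongrightarrow> poly (root_poly ys) t"
      using LIMSEQ_subseq_LIMSEQ[OF lim \<phi>(1)] by (simp add: o_def)
  qed
  then have "root_poly zs = root_poly ys"
    by (simp add: poly_eq_poly_eq_iff[symmetric] fun_eq_iff)
  then have "zs = ys"
    by (metis real_roots_root_poly \<open>sorted zs\<close> sorted(2))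
  have "ys ! i = y i" if "i < length ys" for i
  proof -
    have "zs ! i = y i" using that unfolding zs_def by simp
    with \<open>zs = ys\<close> show ?thesis by (simp only:)
  qed
  with \<phi> show ?thesis by (intro exI[of _ \<phi>]) simp
qed

text \<open>An eigenvector bounds the eigenvalue by the operator norm. The crude constant comes from
  an entrywise bound on that norm.\<close>

lemma eigenvalue_bound:
  fixes A :: "real ^ 'n ^ 'n"
  assumes "x \<in> set (eigenvalues A)"
  shows "\<bar>x\<bar> \<le> real CARD('n) * real CARD('n) * norm A"
proof -
  have "det (x *\<^sub>R mat 1 - A) = 0"
    using assms by (simp add: set_real_roots poly_charpoly)
  then obtain v where v: "v \<noteq> 0" "(x *\<^sub>R mat 1 - A) *v v = 0"
    using det_zero_imp_ker by blast
  have "A *v v = x *\<^sub>R v"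
    using v(2) by (simp add: matrix_vector_mult_diff_rdistrib scaleR_matrix_vector_assoc[symmetric])
  then have "\<bar>x\<bar> * norm v = norm (A *v v)" by simp
  also have "\<dots> \<le> onorm ((*v) A) * norm v" by (rule onorm) (rule matrix_vector_mul_bounded_linear)
  also have "onorm ((*v) A) \<le> real CARD('n) * real CARD('n) * norm A"
  proof (rule onorm_le_matrix_component)
    fix i j
    have "\<bar>A $ i $ j\<bar> \<le> norm (A $ i)" by (rule component_le_norm_cart)
    also have "\<dots> \<le> norm A" by (rule Finite_Cartesian_Product.norm_nth_le)
    finally show "\<bar>A $ i $ j\<bar> \<le> norm A" .
  qed
  finally show ?thesis using v(1) by (simp add: mult_right_mono)
qed

lemma eigenvalues_nth_bound:
  fixes A :: "nat \<Rightarrow> real ^ 'n ^ 'n"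
  assumes "A \<longlonglongrightarrow> L" "\<And>m. A m \<in> Sym2"
  shows "\<exists>B. \<forall>m. \<forall>i<CARD('n). \<bar>eigenvalues (A m) ! i\<bar> \<le> B"
proof -
  obtain C where C: "\<And>m. norm (A m) \<le> C"
    using convergent_imp_Bseq[of A] assms(1) by (auto simp: convergent_def Bseq_def)
  show ?thesis
  proof (intro exI allI impI)
    fix m i assume "i < CARD('n)"
    then have "eigenvalues (A m) ! i \<in> set (eigenvalues (A m))"
      using charpoly_Sym2(2)[OF assms(2)] by simp
    from eigenvalue_bound[OF this] C[of m]
    show "\<bar>eigenvalues (A m) ! i\<bar> \<le> real CARD('n) * real CARD('n) * C"
      by (meson mult_left_mono mult_nonneg_nonneg of_nat_0_le_iff order_trans)
  qed
qed

lemma tendsto_det: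
  fixes A :: "'c \<Rightarrow> real ^ 'n ^ 'n"
  assumes "(A \<longlongrightarrow> L) F"
  shows "((\<lambda>m. det (A m)) \<longlongrightarrow> det L) F"
  unfolding det_def using assms by (intro tendsto_intros)

lemma closed_Sym2: "closed Sym2"
proof -
  have "continuous_on UNIV (\<lambda>A :: real ^ 'n ^ 'n. transpose A)"
    unfolding transpose_def by (intro continuous_intros)
  then show ?thesis
    unfolding Sym2_def by (rule closed_Collect_eq[OF _ continuous_on_id])
qed

lemma tendsto_eigenvalues_subseq:
  fixes A :: "nat \<Rightarrow> real ^ 'n ^ 'n"
  assumes lim: "A \<longlonglongrightarrow> L" and sym: "\<And>m. A m \<in> Sym2"
  shows "\<exists>\<phi>. strict_mono \<phi> \<and>
    (\<forall>i<CARD('n). (\<lambda>m. eigenvalues (A (\<phi> m)) ! i) \<longlonglongrightarrow> eigenvalues L ! i)"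
proof -
  have L: "L \<in> Sym2" using closed_sequentially[OF closed_Sym2 sym lim] .
  obtain B where B: "\<And>m i. i < CARD('n) \<Longrightarrow> \<bar>eigenvalues (A m) ! i\<bar> \<le> B"
    using eigenvalues_nth_bound[OF lim sym] by blast
  note [simp] = charpoly_Sym2(2)[OF L] charpoly_Sym2(2)[OF sym]
  have "\<exists>\<phi>. strict_mono \<phi> \<and>
    (\<forall>i<length (eigenvalues L). (\<lambda>m. eigenvalues (A (\<phi> m)) ! i) \<longlonglongrightarrow> eigenvalues L ! i)"
  proof (rule tendsto_roots_subseq)
    show "(\<lambda>m. poly (root_poly (eigenvalues (A m))) t) \<longlonglongrightarrow> poly (root_poly (eigenvalues L)) t" for t
      unfolding charpoly_Sym2(1)[OF L, symmetric] charpoly_Sym2(1)[OF sym, symmetric] poly_charpoly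
      by (intro tendsto_det tendsto_diff tendsto_const lim)
  qed (use B in simp_all)
  then show ?thesis by simp
qed

text \<open>Interlacing bounds the critical points by the eigenvalue bound. Along a subsequence with
  convergent eigenvalues the derivatives converge pointwise, being polynomial in the
  eigenvalues.\<close>

lemma tendsto_critical_points_subseq:
  fixes A :: "nat \<Rightarrow> real ^ 'n ^ 'n"
  assumes lim: "A \<longlonglongrightarrow> L" and sym: "\<And>m. A m \<in> Sym2"
  shows "\<exists>\<phi>. strict_mono \<phi> \<and>
    (\<forall>i<CARD('n) - 1. (\<lambda>m. critical_points (A (\<phi> m)) ! i) \<longlonglongrightarrow> critical_points L ! i)"
proof -
  have L: "L \<in> Sym2" using closed_sequentially[OF closed_Sym2 sym lim] .
  obtain B where B: "\<And>m i. i < CARD('n) \<Longrightarrow> \<bar>eigenvalues (A m) ! i\<bar> \<le> B"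
    using eigenvalues_nth_bound[OF lim sym] by blast
  obtain \<phi> where \<phi>: "strict_mono \<phi>"
    "\<And>i. i < CARD('n) \<Longrightarrow> (\<lambda>m. eigenvalues (A (\<phi> m)) ! i) \<longlonglongrightarrow> eigenvalues L ! i"
    using tendsto_eigenvalues_subseq[OF lim sym] by blast
  note len = critical_points_Sym2(1)[OF L] critical_points_Sym2(1)[OF sym]
  have pderiv: "poly (root_poly (critical_points M)) t = poly (pderiv (root_poly (eigenvalues M))) t / CARD('n)"
    if "M \<in> Sym2" for M :: "real ^ 'n ^ 'n" and t
    using arg_cong[OF critical_points_Sym2(2)[OF that], of "\<lambda>p. poly p t"]
    unfolding charpoly_Sym2(1)[OF that, symmetric] by simp
  have "\<exists>\<psi>. strict_mono \<psi> \<and> (\<forall>i<length (critical_points L).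
      (\<lambda>m. critical_points (A (\<phi> (\<psi> m))) ! i) \<longlonglongrightarrow> critical_points L ! i)"
  proof (rule tendsto_roots_subseq)
    fix m i assume "i < length (critical_points L)"
    then have i: "Suc i < CARD('n)" using len by simp
    show "\<bar>critical_points (A (\<phi> m)) ! i\<bar> \<le> B"
      using critical_points_Sym2(3)[OF sym[of "\<phi> m"] i] B[of i "\<phi> m"] B[of "Suc i" "\<phi> m"] i by auto
  next
    fix t
    show "(\<lambda>m. poly (root_poly (critical_points (A (\<phi> m)))) t)
        \<longlonglongrightarrow> poly (root_poly (critical_points L)) t"
      unfolding pderiv[OF L] pderiv[OF sym] poly_pderiv_root_poly
        charpoly_Sym2(2)[OF L] charpoly_Sym2(2)[OF sym]
      by (intro tendsto_divide tendsto_sum tendsto_prod tendsto_diff tendsto_const \<phi>(2)) auto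
  qed (simp_all add: len)
  then obtain \<psi> where "strict_mono \<psi>" "\<forall>i<CARD('n) - 1.
      (\<lambda>m. critical_points (A (\<phi> (\<psi> m))) ! i) \<longlonglongrightarrow> critical_points L ! i"
    unfolding len by blast
  then show ?thesis using strict_mono_o[OF \<phi>(1)] by (auto intro!: exI[of _ "\<phi> \<circ> \<psi>"])
qed

section \<open>Closures of the asymptotic interiors\<close>

lemma closed_nonneg_Sym2:
  fixes g :: "real ^ 'n ^ 'n \<Rightarrow> real"
  assumes "\<And>A L. A \<longlonglongrightarrow> L \<Longrightarrow> (\<And>m. A m \<in> Sym2) \<Longrightarrow>
    \<exists>\<phi>. strict_mono \<phi> \<and> (\<lambda>m. g (A (\<phi> m))) \<longlonglongrightarrow> g L"
  shows "closed {A \<in> Sym2. g A \<ge> 0}"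
  unfolding closed_sequential_limits
proof (intro allI impI, elim conjE)
  fix A L assume A: "\<forall>m. A m \<in> {A \<in> Sym2. g A \<ge> 0}" "A \<longlonglongrightarrow> L"
  then have sym: "A m \<in> Sym2" for m by simp
  have "L \<in> Sym2" using closed_sequentially[OF closed_Sym2 sym A(2)] .
  moreover obtain \<phi> where "strict_mono \<phi>" "(\<lambda>m. g (A (\<phi> m))) \<longlonglongrightarrow> g L"
    using assms[OF A(2) sym] by blast
  then have "g L \<ge> 0" using A(1) by (intro LIMSEQ_le_const) auto
  ultimately show "L \<in> {A \<in> Sym2. g A \<ge> 0}" by simp
qed

text \<open>Adding a small positive multiple of the identity makes a nonnegative value of
  \<open>g\<close> positive; the other inclusion is closedness.\<close>

lemma closure_pos_Sym2:
  fixes g :: "real ^ 'n ^ 'n \<Rightarrow> real"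
  assumes closed: "closed {A \<in> Sym2. g A \<ge> 0}"
    and shift: "\<And>A e. A \<in> Sym2 \<Longrightarrow> g (A - e *\<^sub>R mat 1) = g A - e"
  shows "closure {A \<in> Sym2. g A > 0} = {A \<in> Sym2. g A \<ge> 0}"
proof
  show "closure {A \<in> Sym2. g A > 0} \<subseteq> {A \<in> Sym2. g A \<ge> 0}"
    using closed by (intro closure_minimal) auto
  show "{A \<in> Sym2. g A \<ge> 0} \<subseteq> closure {A \<in> Sym2. g A > 0}"
  proof
    fix A assume A: "A \<in> {A \<in> Sym2. g A \<ge> 0}"
    \<comment> \<open>This is \<open>A\<close> plus \<open>1 / (m + 1)\<close> times the identity,
      written as a difference to fit \<open>shift\<close>.\<close>
    let ?A = "\<lambda>m. A - (- inverse (real (Suc m))) *\<^sub>R mat 1"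
    have "?A m \<in> {A \<in> Sym2. g A > 0}" for m
    proof -
      have "?A m \<in> Sym2" using Sym2_shift[of A 1 "- inverse (real (Suc m))"] A
        by (simp only: scaleR_one mem_Collect_eq)
      moreover have "g (?A m) = g A + inverse (real (Suc m))"
        using shift[of A "- inverse (real (Suc m))"] A by (simp del: scaleR_minus_left)
      ultimately show ?thesis using A by (simp add: add_nonneg_pos)
    qed
    moreover have "?A \<longlonglongrightarrow> A - (- 0) *\<^sub>R mat 1"
      by (intro tendsto_intros LIMSEQ_inverse_real_of_nat)
    ultimately show "A \<in> closure {A \<in> Sym2. g A > 0}"
      unfolding closure_sequential by (intro exI[of _ ?A]) simp
  qed
qed

lemma closure_eigval_pos:
  assumes "k \<in> {1..CARD('n)}"
  shows "closure {A :: real ^ 'n ^ 'n \<in> Sym2. eigval k A > 0} = Lambda k"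
  unfolding Lambda_def
proof (rule closure_pos_Sym2)
  have k: "k - 1 < CARD('n)" using assms by auto
  show "closed {A :: real ^ 'n ^ 'n \<in> Sym2. eigval k A \<ge> 0}"
    unfolding eigval_eq_nth using tendsto_eigenvalues_subseq k
    by (intro closed_nonneg_Sym2) blast
  show "eigval k (A - e *\<^sub>R mat 1) = eigval k A - e" if "A \<in> Sym2" for A :: "real ^ 'n ^ 'n" and e
    using eigenvalues_affine[OF that zero_less_one, of e] k charpoly_Sym2(2)[OF that]
    by (simp add: eigval_eq_nth)
qed

lemma closure_sigma_eigval_pos:
  assumes "k \<in> {1..CARD('n) - 1}"
  shows "closure {A :: real ^ 'n ^ 'n \<in> Sym2. sigma_eigval (CARD('n) - 1) k A > 0} =
    Lambda_sigma (CARD('n) - 1) k"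
proof -
  have k: "k - 1 < CARD('n) - 1" using assms by auto
  let ?g = "\<lambda>A :: real ^ 'n ^ 'n. critical_points A ! (k - 1)"
  have "closure {A \<in> Sym2. ?g A > 0} = {A \<in> Sym2. ?g A \<ge> 0}"
  proof (rule closure_pos_Sym2)
    show "closed {A \<in> Sym2. ?g A \<ge> 0}"
      using tendsto_critical_points_subseq k by (intro closed_nonneg_Sym2) blast
    show "?g (A - e *\<^sub>R mat 1) = ?g A - e" if "A \<in> Sym2" for A :: "real ^ 'n ^ 'n" and e
      using critical_points_affine[OF that zero_less_one, of e] k critical_points_Sym2(1)[OF that]
      by simp
  qed
  \<comment> \<open>With \<open>R\<close> arbitrary, one rewriting serves both the strict and the
    weak inequality.\<close>
  moreover have "{A \<in> Sym2. R (sigma_eigval (CARD('n) - 1) k A)} = {A \<in> Sym2. R (?g A)}" for R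
    using sigma_eigval_eq_nth by (intro Collect_cong conj_cong refl arg_cong[of _ _ R])
  ultimately show ?thesis unfolding Lambda_sigma_def by simp
qed

theorem theorem4p1:
  fixes \<theta> :: real
  assumes "\<theta> \<in> {- (real CARD('n::finite) * (pi / 2)) <..< real CARD('n) * (pi / 2)}"
  shows "(\<forall>k \<in> {1..CARD('n)}.
            \<theta> \<in> {(real CARD('n) - 2 * real k) * (pi / 2) <..<
                  (real CARD('n) - 2 * (real k - 1)) * (pi / 2)} \<longrightarrow>
            asymptotic_subequation (F_arctan \<theta> :: (real ^ 'n ^ 'n) set) = Lambda k) \<and>
         (\<forall>k \<in> {1..CARD('n) - 1}.
            \<theta> = (real CARD('n) - 2 * real k) * (pi / 2) \<longrightarrow>
            asymptotic_subequation (F_arctan \<theta> :: (real ^ 'n ^ 'n) set) =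
              Lambda_sigma (CARD('n) - 1) k)"
  unfolding asymptotic_subequation_def
proof (intro conjI ballI impI, goal_cases)
  case (1 k)
  show ?case
    unfolding asymptotic_interior_generic[OF 1] by (rule closure_eigval_pos[OF 1(1)])
next
  case (2 k)
  show ?case
    unfolding asymptotic_interior_critical[OF 2] by (rule closure_sigma_eigval_pos[OF 2(1)])
qed

end
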